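(* Let $P$ be a finite poset with $w(P)=s\ge 2$. Let $l\ge 2$ be an integer and put $L=\min\{l-1,s-1\}$. If $n$ and $t$ are integers with $n\ge L$ and $1\le t\le n-L+1$, then \[ \operatorname{RT}^{\sharp}(\mathcal{B};n,P,l,t)\ge L\binom{n-L+1}{t}. \] Consequently, for every fixed finite poset $P$ that is not a chain and all fixed integers $l\ge 2$ and $t\ge 1$, we have \[ \operatorname{RT}^{\sharp}(\mathcal{B};n,P,l,t)=\Theta(n^t)\qquad(n\to\infty) \] whenever $\min\{l-1,w(P)-1\}\ge 1$.
   Context: $B_n$ is the power set of $[n]=\{1,\dots,n\}$ ordered by inclusion; a subset $Q\subseteq B_n$ (possibly empty) is regarded as a poset with the induced order. A $t$-chain in a poset is a set of exactly $t$ distinct pairwise comparable elements, and $\mathcal{C}_t(Q)$ is the set of all $t$-chains of $Q$. The width $w(Q)$ of a poset is the size of a largest antichain. An injection $f:P\to Q$ between posets is a strong embedding if $x\le y$ in $P$ if and only if $f(x)\le f(y)$ in $Q$. $Q$ is strongly $P$-free if there is no strong embedding of $P$ into $Q$. $\operatorname{RT}^{\sharp}(\mathcal{B};n,P,l,t)$ is the maximum of $|\mathcal{C}_t(Q)|$ over all $Q\subseteq B_n$ such that $Q$ is strongly $P$-free and $w(Q)<l$. $a_n=\Theta(b_n)$ means that there are constants $c,C>0$ with $c\,b_n\le a_n\le C\,b_n$ for all sufficiently large $n$. *)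

theory Defs
  imports Complex_Main "HOL-Library.Landau_Symbols"
begin

text \<open>A finite poset is rendered as a finite subset of a type of class \<^class>\<open>order\<close>, with the
  induced order. On \<^typ>\<open>nat set\<close> this order is inclusion, so that families of subsets of
  \<open>{1..n}\<close> are posets in the same sense.\<close>

definition antichain :: "'a::order set \<Rightarrow> bool" where
  "antichain A \<longleftrightarrow> pairwise (\<lambda>x y. \<not> x \<le> y) A"

text \<open>Meaningful only for finite \<open>Q\<close>; the empty antichain makes the maximum well defined.\<close>

definition poset_width :: "'a::order set \<Rightarrow> nat" where
  "poset_width Q = Max {card A |A. A \<subseteq> Q \<and> antichain A}"

definition t_chains :: "nat \<Rightarrow> 'a::order set \<Rightarrow> 'a set set" where
  "t_chains t Q = {C. C \<subseteq> Q \<and> finite C \<and> card C = t \<and> Complete_Partial_Order.chain (\<le>) C}"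

definition strong_embedding :: "('a::order \<Rightarrow> 'b::order) \<Rightarrow> 'a set \<Rightarrow> 'b set \<Rightarrow> bool" where
  "strong_embedding f P Q \<longleftrightarrow>
     inj_on f P \<and> f ` P \<subseteq> Q \<and> (\<forall>x\<in>P. \<forall>y\<in>P. x \<le> y \<longleftrightarrow> f x \<le> f y)"

definition strongly_free :: "'a::order set \<Rightarrow> 'b::order set \<Rightarrow> bool" where
  "strongly_free P Q \<longleftrightarrow> (\<nexists>f. strong_embedding f P Q)"

definition boolean_lattice :: "nat \<Rightarrow> nat set set" where
  "boolean_lattice n = Pow {1..n}"

text \<open>The admissible families always form a finite set, which contains \<open>{}\<close> when \<open>P \<noteq> {}\<close> and
  \<open>l \<ge> 1\<close>; see the two lemmas below.\<close>

definition RT_sharp :: "nat \<Rightarrow> 'a::order set \<Rightarrow> nat \<Rightarrow> nat \<Rightarrow> nat" where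
  "RT_sharp n P l t =
     Max {card (t_chains t Q) |Q. Q \<subseteq> boolean_lattice n \<and> strongly_free P Q \<and> poset_width Q < l}"

lemma finite_RT_sharp_candidates:
  "finite {card (t_chains t Q) |Q. Q \<subseteq> boolean_lattice n \<and> strongly_free P Q \<and> poset_width Q < l}"
proof -
  have "finite {Q. Q \<subseteq> boolean_lattice n}"
    by (simp add: boolean_lattice_def)
  then have "finite ((\<lambda>Q. card (t_chains t Q)) ` {Q. Q \<subseteq> boolean_lattice n})"
    by (rule finite_imageI)
  then show ?thesis
    by (rule rev_finite_subset) auto
qed

lemma RT_sharp_candidate_empty:
  assumes "P \<noteq> {}" and "l \<ge> 1"
  shows "{} \<subseteq> boolean_lattice n \<and> strongly_free P {} \<and> poset_width ({} :: nat set set) < l"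
proof -
  have "{card A |A. A \<subseteq> ({} :: nat set set) \<and> antichain A} = {0}"
    by (auto simp: antichain_def)
  then show ?thesis
    using assms by (simp add: strongly_free_def strong_embedding_def poset_width_def)
qed

end

theory Submission
  imports Defs "HOL-Library.Disjoint_Sets"
begin

text \<open>Write \<open>L = min (l - 1) (s - 1)\<close>.  A strong embedding carries antichains to antichains of the
  same size, so every family of width at most \<open>L\<close> is both strongly \<open>P\<close>-free
  (\<open>strongly_free_if_width_less\<close>) and of width less than \<open>l\<close>.  The lower bound therefore only needs
  a family that is a union of \<open>L\<close> disjoint chains of \<open>n - L + 1\<close> sets each: its width is at
  most \<open>L\<close> by the pigeonhole principle, and the \<open>t\<close>-subsets of the single chains are already
  \<open>L * (n - L + 1 choose t)\<close> different \<open>t\<close>-chains.  Such chains arise by spending the ground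
  elements \<open>1, \<dots>, L\<close> as labels: the \<open>i\<close>-th chain starts at \<open>{i}\<close> and adds the elements
  \<open>L + 1, \<dots>, n\<close> one after the other.

  For fixed \<open>l\<close> and \<open>t\<close> this lower bound has order \<open>n ^ t\<close>.  For the matching upper bound,
  the sets of a given size in a family form an antichain, and there are \<open>n + 1\<close> sizes; so an
  admissible family has at most \<open>(l - 1) * (n + 1)\<close> members, and hence at most
  \<open>((l - 1) * (n + 1)) ^ t\<close> subsets of size \<open>t\<close>, whether chains or not.\<close>

section \<open>Width and strong embeddings\<close>

lemma finite_antichain_cards:
  assumes "finite (Q :: 'a::order set)"
  shows "finite {card A |A. A \<subseteq> Q \<and> antichain A}"
proof -
  have "{card A |A. A \<subseteq> Q \<and> antichain A} \<subseteq> card ` Pow Q"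
    by auto
  then show ?thesis
    using assms finite_subset by blast
qed

lemma card_antichain_le_width:
  assumes "finite (Q :: 'a::order set)" "A \<subseteq> Q" "antichain A"
  shows "card A \<le> poset_width Q"
  unfolding poset_width_def
  by (rule Max_ge[OF finite_antichain_cards[OF assms(1)]]) (use assms in auto)

lemma width_attained:
  assumes "finite (Q :: 'a::order set)"
  obtains A where "A \<subseteq> Q" "antichain A" "card A = poset_width Q"
proof -
  have "antichain ({} :: 'a set)"
    by (simp add: antichain_def)
  then have "{card A |A. A \<subseteq> Q \<and> antichain A} \<noteq> {}"
    by blast
  then have "poset_width Q \<in> {card A |A. A \<subseteq> Q \<and> antichain A}"
    unfolding poset_width_def by (rule Max_in[OF finite_antichain_cards[OF assms]])
  with that show thesis
    by auto
qed

lemma strong_embedding_image_antichain: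
  assumes "strong_embedding f P Q" "A \<subseteq> P" "antichain A"
  shows "antichain (f ` A)"
proof -
  have "\<not> f x \<le> f y" if "x \<in> A" "y \<in> A" "f x \<noteq> f y" for x y
  proof -
    have "x \<noteq> y" "x \<in> P" "y \<in> P"
      using that assms(2) by auto
    moreover have "\<not> x \<le> y"
      using assms(3) that \<open>x \<noteq> y\<close> by (simp add: antichain_def pairwise_def)
    ultimately show ?thesis
      using assms(1) by (simp add: strong_embedding_def)
  qed
  then show ?thesis
    by (auto simp: antichain_def pairwise_def)
qed

lemma strongly_free_if_width_less:
  assumes "finite P" "finite Q" "poset_width Q < poset_width P"
  shows "strongly_free P Q"
  unfolding strongly_free_def
proof
  assume "\<exists>f. strong_embedding f P Q"
  then obtain f where f: "strong_embedding f P Q"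
    by blast
  obtain A where A: "A \<subseteq> P" "antichain A" "card A = poset_width P"
    using width_attained[OF assms(1)] .
  have "card (f ` A) = card A"
    using f A(1) unfolding strong_embedding_def by (meson card_image inj_on_subset)
  moreover have "card (f ` A) \<le> poset_width Q"
    using f A strong_embedding_image_antichain[OF f A(1,2)]
    by (intro card_antichain_le_width[OF assms(2)]) (auto simp: strong_embedding_def)
  ultimately show False
    using A(3) assms(3) by simp
qed

section \<open>Unions of chains\<close>

text \<open>An antichain meets each chain in at most one point: the easy half of Dilworth's theorem.\<close>

lemma width_UN_chains_le:
  fixes C :: "'i \<Rightarrow> 'a::order set"
  assumes "finite I" "\<And>i. i \<in> I \<Longrightarrow> finite (C i)"
    and chain: "\<And>i. i \<in> I \<Longrightarrow> Complete_Partial_Order.chain (\<le>) (C i)"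
  shows "poset_width (\<Union>i\<in>I. C i) \<le> card I"
proof -
  have fin: "finite (\<Union>i\<in>I. C i)"
    using assms(1,2) by simp
  obtain A where A: "A \<subseteq> (\<Union>i\<in>I. C i)" "antichain A"
      "card A = poset_width (\<Union>i\<in>I. C i)"
    using width_attained[OF fin] .
  have "\<forall>x\<in>A. \<exists>i. i \<in> I \<and> x \<in> C i"
    using A(1) by blast
  then obtain g where g: "\<And>x. x \<in> A \<Longrightarrow> g x \<in> I" "\<And>x. x \<in> A \<Longrightarrow> x \<in> C (g x)"
    by metis
  have "inj_on g A"
  proof (rule inj_onI)
    fix x y assume xy: "x \<in> A" "y \<in> A" "g x = g y"
    then have "x \<le> y \<or> y \<le> x"
      using chainD[OF chain[OF g(1)[OF xy(1)]], of x y] g(2)[of x] g(2)[of y] by simp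
    then show "x = y"
      using A(2) xy(1,2) unfolding antichain_def pairwise_def by metis
  qed
  then have "card A \<le> card I"
    using g(1) assms(1) by (intro card_inj_on_le[of g]) auto
  with A(3) show ?thesis
    by simp
qed

lemma finite_t_chains: "finite Q \<Longrightarrow> finite (t_chains t Q)"
  by (rule finite_subset[of _ "Pow Q"]) (auto simp: t_chains_def)

lemma subset_of_chain_in_t_chains:
  assumes "Complete_Partial_Order.chain (\<le>) C" "finite C" "C \<subseteq> Q" "X \<subseteq> C" "card X = t"
  shows "X \<in> t_chains t Q"
  using assms finite_subset[OF assms(4,2)] chain_subset[OF assms(1,4)]
  by (simp add: t_chains_def)

text \<open>Nonempty subsets of different disjoint chains differ, so that the chains contribute
  separately; for \<open>t = 0\<close> they would share the empty chain.\<close>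

lemma card_t_chains_UN_ge:
  fixes C :: "'i \<Rightarrow> 'a::order set"
  assumes "finite I" "\<And>i. i \<in> I \<Longrightarrow> finite (C i)"
    and chain: "\<And>i. i \<in> I \<Longrightarrow> Complete_Partial_Order.chain (\<le>) (C i)"
    and disj: "disjoint_family_on C I" and "t \<ge> 1"
  shows "(\<Sum>i\<in>I. card (C i) choose t) \<le> card (t_chains t (\<Union>i\<in>I. C i))"
proof -
  let ?S = "\<lambda>i. {X. X \<subseteq> C i \<and> card X = t}"
  have "?S i \<inter> ?S j = {}" if "i \<in> I" "j \<in> I" "i \<noteq> j" for i j
  proof -
    have "C i \<inter> C j = {}"
      using disj that by (auto simp: disjoint_family_on_def)
    have False if "X \<in> ?S i" "X \<in> ?S j" for X
    proof -
      have "X = {}"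
        using that \<open>C i \<inter> C j = {}\<close> by blast
      with that(1) \<open>t \<ge> 1\<close> show False
        by simp
    qed
    then show ?thesis
      by blast
  qed
  moreover have "finite (?S i)" if "i \<in> I" for i
    using assms(2)[OF that] by simp
  ultimately have "card (\<Union>i\<in>I. ?S i) = (\<Sum>i\<in>I. card (?S i))"
    using assms(1) by (intro card_UN_disjoint) auto
  also have "\<dots> = (\<Sum>i\<in>I. card (C i) choose t)"
    using assms(2) by (intro sum.cong refl n_subsets) auto
  finally have "(\<Sum>i\<in>I. card (C i) choose t) = card (\<Union>i\<in>I. ?S i)" ..
  also have "\<dots> \<le> card (t_chains t (\<Union>i\<in>I. C i))"
  proof (rule card_mono)
    show "finite (t_chains t (\<Union>i\<in>I. C i))"
      using assms(1,2) by (intro finite_t_chains) simp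
    show "(\<Union>i\<in>I. ?S i) \<subseteq> t_chains t (\<Union>i\<in>I. C i)"
    proof
      fix X assume "X \<in> (\<Union>i\<in>I. ?S i)"
      then obtain i where i: "i \<in> I" "X \<subseteq> C i" "card X = t"
        by blast
      then show "X \<in> t_chains t (\<Union>i\<in>I. C i)"
        using subset_of_chain_in_t_chains[OF chain[OF i(1)] assms(2)[OF i(1)], of _ X t] by blast
    qed
  qed
  finally show ?thesis .
qed

section \<open>The lower bound\<close>

definition labelled_chain :: "nat \<Rightarrow> nat \<Rightarrow> nat \<Rightarrow> nat set set" where
  "labelled_chain n L i = (\<lambda>k. insert i {L<..L + k}) ` {..n - L}"

lemma chain_labelled_chain: "Complete_Partial_Order.chain (\<le>) (labelled_chain n L i)"
proof (rule chainI)
  fix X Y assume "X \<in> labelled_chain n L i" "Y \<in> labelled_chain n L i"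
  then obtain j k where XY: "X = insert i {L<..L + j}" "Y = insert i {L<..L + k}"
    by (auto simp: labelled_chain_def)
  show "X \<le> Y \<or> Y \<le> X"
    unfolding XY by (cases "j \<le> k") auto
qed

lemma card_labelled_chain:
  assumes "i \<le> L"
  shows "card (labelled_chain n L i) = n - L + 1"
proof -
  have card: "card (insert i {L<..L + k}) = Suc k" for k
    using assms by simp
  have "inj (\<lambda>k. insert i {L<..L + k})"
  proof (rule injI)
    fix j k assume "insert i {L<..L + j} = insert i {L<..L + k}"
    then have "card (insert i {L<..L + j}) = card (insert i {L<..L + k})"
      by (rule arg_cong)
    then show "j = k"
      unfolding card by simp
  qed
  then have "card (labelled_chain n L i) = card {..n - L}"
    unfolding labelled_chain_def by (rule card_image[OF inj_on_subset[OF _ subset_UNIV]])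
  then show ?thesis
    by simp
qed

lemma finite_labelled_chain: "finite (labelled_chain n L i)"
  by (simp add: labelled_chain_def)

lemma disjoint_labelled_chains: "disjoint_family_on (labelled_chain n L) {1..L}"
proof -
  \<comment> \<open>The label of a chain is recovered from each of its members by intersecting with \<open>{1..L}\<close>.\<close>
  have label: "X \<inter> {1..L} = {i}" if "i \<in> {1..L}" "X \<in> labelled_chain n L i" for i X
    using that by (auto simp: labelled_chain_def)
  show ?thesis
    unfolding disjoint_family_on_def
  proof (intro ballI impI)
    fix i j assume ij: "i \<in> {1..L}" "j \<in> {1..L}" "i \<noteq> j"
    have "X \<notin> labelled_chain n L j" if "X \<in> labelled_chain n L i" for X
      using label[OF ij(1) that] label[OF ij(2), of X] ij(3) by auto
    then show "labelled_chain n L i \<inter> labelled_chain n L j = {}"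
      by blast
  qed
qed

lemma labelled_chain_subset:
  assumes "i \<in> {1..L}" "L \<le> n"
  shows "labelled_chain n L i \<subseteq> boolean_lattice n"
  using assms by (auto simp: labelled_chain_def boolean_lattice_def)

lemma RT_sharp_ge:
  assumes "Q \<subseteq> boolean_lattice n" "strongly_free P Q" "poset_width Q < l"
  shows "card (t_chains t Q) \<le> RT_sharp n P l t"
  unfolding RT_sharp_def
  by (rule Max_ge[OF finite_RT_sharp_candidates]) (use assms in blast)

lemma RT_sharp_lower_bound:
  assumes "finite P" "L < poset_width P" "L < l" "L \<le> n" "t \<ge> 1"
  shows "L * ((n - L + 1) choose t) \<le> RT_sharp n P l t"
proof -
  define Q where "Q = (\<Union>i\<in>{1..L}. labelled_chain n L i)"
  have "finite Q"
    by (simp add: Q_def finite_labelled_chain)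
  have "poset_width Q \<le> card {1..L}"
    unfolding Q_def by (intro width_UN_chains_le) (simp_all add: finite_labelled_chain chain_labelled_chain)
  then have width: "poset_width Q \<le> L"
    by simp
  have "L * ((n - L + 1) choose t) = (\<Sum>i\<in>{1..L}. card (labelled_chain n L i) choose t)"
    by (simp add: card_labelled_chain)
  also have "\<dots> \<le> card (t_chains t Q)"
    unfolding Q_def using \<open>t \<ge> 1\<close>
    by (intro card_t_chains_UN_ge disjoint_labelled_chains)
      (simp_all add: finite_labelled_chain chain_labelled_chain)
  also have "\<dots> \<le> RT_sharp n P l t"
  proof (rule RT_sharp_ge)
    show "Q \<subseteq> boolean_lattice n"
      unfolding Q_def using labelled_chain_subset[OF _ \<open>L \<le> n\<close>] by blast
    show "strongly_free P Q"
      using width \<open>L < poset_width P\<close>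
      by (intro strongly_free_if_width_less \<open>finite P\<close> \<open>finite Q\<close>) simp
    show "poset_width Q < l"
      using width \<open>L < l\<close> by simp
  qed
  finally show ?thesis .
qed

section \<open>The upper bound\<close>

lemma antichain_same_card:
  assumes "\<And>X. X \<in> A \<Longrightarrow> finite X \<and> card X = k"
  shows "antichain A"
  unfolding antichain_def
proof (rule pairwiseI, rule notI)
  fix X Y assume "X \<in> A" "Y \<in> A" "X \<noteq> Y" "X \<subseteq> Y"
  moreover have "finite Y" "card X = card Y"
    using assms[OF \<open>X \<in> A\<close>] assms[OF \<open>Y \<in> A\<close>] by simp_all
  ultimately show False
    using card_subset_eq by metis
qed

lemma card_le_width_times_levels:
  assumes "Q \<subseteq> boolean_lattice n"
  shows "card Q \<le> poset_width Q * (n + 1)"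
proof -
  have fin: "finite X" "card X \<le> n" if "X \<in> Q" for X
    using assms that card_mono[of "{1..n}" X] finite_subset[of X "{1..n}"]
    by (auto simp: boolean_lattice_def)
  have "finite Q"
    using assms by (rule finite_subset) (simp add: boolean_lattice_def)
  have "Q = (\<Union>k\<in>{..n}. {X \<in> Q. card X = k})"
    using fin by auto
  then have "card Q \<le> (\<Sum>k\<in>{..n}. card {X \<in> Q. card X = k})"
    using card_UN_le[of "{..n}" "\<lambda>k. {X \<in> Q. card X = k}"] by simp
  also have "\<dots> \<le> (\<Sum>k\<in>{..n}. poset_width Q)"
    using fin \<open>finite Q\<close>
    by (intro sum_mono card_antichain_le_width antichain_same_card) auto
  finally show ?thesis
    by (simp add: mult.commute)
qed

lemma card_t_chains_le_power:
  assumes "finite Q"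
  shows "card (t_chains t Q) \<le> card Q ^ t"
proof -
  have "card (t_chains t Q) \<le> card {X. X \<subseteq> Q \<and> card X = t}"
    using assms by (intro card_mono) (auto simp: t_chains_def)
  also have "\<dots> = card Q choose t"
    using assms by (rule n_subsets)
  also have "\<dots> \<le> card Q ^ t"
    by (cases "t \<le> card Q") (simp_all add: binomial_le_pow binomial_eq_0)
  finally show ?thesis .
qed

lemma RT_sharp_upper_bound:
  assumes "P \<noteq> {}" "l \<ge> 1"
  shows "RT_sharp n P l t \<le> ((l - 1) * (n + 1)) ^ t"
  unfolding RT_sharp_def
proof (rule Max.boundedI[OF finite_RT_sharp_candidates])
  show "{card (t_chains t Q) |Q. Q \<subseteq> boolean_lattice n \<and> strongly_free P Q \<and> poset_width Q < l} \<noteq> {}"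
    using RT_sharp_candidate_empty[OF assms, of n] by blast
next
  fix m
  assume "m \<in> {card (t_chains t Q) |Q. Q \<subseteq> boolean_lattice n \<and> strongly_free P Q \<and> poset_width Q < l}"
  then obtain Q where Q: "m = card (t_chains t Q)" "Q \<subseteq> boolean_lattice n" "poset_width Q < l"
    by blast
  have "finite Q"
    using Q(2) by (rule finite_subset) (simp add: boolean_lattice_def)
  have "card Q \<le> poset_width Q * (n + 1)"
    by (rule card_le_width_times_levels[OF Q(2)])
  also have "\<dots> \<le> (l - 1) * (n + 1)"
    using Q(3) by (intro mult_right_mono) auto
  finally have "card Q ^ t \<le> ((l - 1) * (n + 1)) ^ t"
    by (rule power_mono) simp
  with card_t_chains_le_power[OF \<open>finite Q\<close>, of t] Q(1)
  show "m \<le> ((l - 1) * (n + 1)) ^ t"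
    by simp
qed

section \<open>The order of magnitude\<close>

lemma RT_sharp_bigtheta:
  fixes P :: "'a::order set"
  assumes "finite P" "L \<ge> 1" "L < poset_width P" "L < l" "t \<ge> 1"
  shows "(\<lambda>n. real (RT_sharp n P l t)) \<in> \<Theta>(\<lambda>n. real n ^ t)"
proof (rule bigthetaI)
  have "P \<noteq> {}"
  proof
    assume "P = {}"
    then have "{card A |A. A \<subseteq> P \<and> antichain A} = {0}"
      by (auto simp: antichain_def)
    then show False
      using assms(3) by (simp add: poset_width_def)
  qed
  have "real (RT_sharp n P l t) \<le> (2 * real (l - 1)) ^ t * real n ^ t" if "n \<ge> 1" for n
  proof -
    have "RT_sharp n P l t \<le> ((l - 1) * (n + 1)) ^ t"
      using RT_sharp_upper_bound[OF \<open>P \<noteq> {}\<close>] assms(4) by simp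
    also have "\<dots> \<le> ((l - 1) * (2 * n)) ^ t"
      using that by (intro power_mono mult_left_mono) auto
    also have "\<dots> = (2 * (l - 1)) ^ t * n ^ t"
      by (simp add: power_mult_distrib)
    finally have "real (RT_sharp n P l t) \<le> real ((2 * (l - 1)) ^ t * n ^ t)"
      by (rule of_nat_mono)
    then show ?thesis
      by simp
  qed
  then have "eventually (\<lambda>n. norm (real (RT_sharp n P l t))
      \<le> (2 * real (l - 1)) ^ t * norm (real n ^ t)) at_top"
    by (auto simp: eventually_at_top_linorder)
  then show "(\<lambda>n. real (RT_sharp n P l t)) \<in> O(\<lambda>n. real n ^ t)"
    by (rule bigoI)
next
  have "(1 / (2 * real t)) ^ t * real n ^ t \<le> real (RT_sharp n P l t)" if n: "n \<ge> 2 * (L + t)" for n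
  proof -
    define m where "m = n - L + 1"
    \<comment> \<open>The binomial coefficient is at least \<open>(m / t) ^ t\<close>, and \<open>m\<close> is at least half of \<open>n\<close>.\<close>
    have m: "t \<le> m" "real n \<le> 2 * real m"
      using n by (auto simp: m_def)
    have "(1 / (2 * real t)) ^ t * real n ^ t = (real n / (2 * real t)) ^ t"
      by (simp add: power_divide)
    also have "\<dots> \<le> (real m / real t) ^ t"
      using m \<open>t \<ge> 1\<close> by (intro power_mono) (auto simp: field_simps)
    also have "\<dots> \<le> real (m choose t)"
      using binomial_ge_n_over_k_pow_k[OF m(1), where 'a = real] by simp
    also have "\<dots> \<le> real (L * (m choose t))"
      using \<open>L \<ge> 1\<close> by (intro of_nat_mono) simp
    also have "\<dots> \<le> real (RT_sharp n P l t)"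
      using RT_sharp_lower_bound[OF assms(1,3,4) _ \<open>t \<ge> 1\<close>, of n] n
      by (intro of_nat_mono) (simp add: m_def)
    finally show ?thesis .
  qed
  then have "eventually (\<lambda>n. (1 / (2 * real t)) ^ t * norm (real n ^ t)
      \<le> norm (real (RT_sharp n P l t))) at_top"
    by (auto simp: eventually_at_top_linorder)
  then show "(\<lambda>n. real (RT_sharp n P l t)) \<in> \<Omega>(\<lambda>n. real n ^ t)"
    using \<open>t \<ge> 1\<close> by (intro landau_omega.bigI[of "(1 / (2 * real t)) ^ t"]) auto
qed

theorem theorem1p2:
  fixes P :: "'a::order set"
  assumes "finite P"
  shows "(\<forall>s l L n t :: nat.
            poset_width P = s \<longrightarrow> s \<ge> 2 \<longrightarrow> l \<ge> 2 \<longrightarrow> L = min (l - 1) (s - 1) \<longrightarrow>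
            n \<ge> L \<longrightarrow> 1 \<le> t \<longrightarrow> t \<le> n - L + 1 \<longrightarrow>
            RT_sharp n P l t \<ge> L * ((n - L + 1) choose t)) \<and>
         (\<forall>l t :: nat.
            \<not> Complete_Partial_Order.chain (\<le>) P \<longrightarrow> l \<ge> 2 \<longrightarrow> t \<ge> 1 \<longrightarrow>
            min (l - 1) (poset_width P - 1) \<ge> 1 \<longrightarrow>
            (\<lambda>n. real (RT_sharp n P l t)) \<in> \<Theta>(\<lambda>n. real n ^ t))"
proof (intro conjI allI impI)
  fix s l L n t :: nat
  assume "poset_width P = s" "s \<ge> 2" "l \<ge> 2" "L = min (l - 1) (s - 1)" "n \<ge> L" "1 \<le> t"
  then show "RT_sharp n P l t \<ge> L * ((n - L + 1) choose t)"
    by (intro RT_sharp_lower_bound assms) auto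
next
  fix l t :: nat
  assume "l \<ge> 2" "t \<ge> 1" "min (l - 1) (poset_width P - 1) \<ge> 1"
  then show "(\<lambda>n. real (RT_sharp n P l t)) \<in> \<Theta>(\<lambda>n. real n ^ t)"
    by (intro RT_sharp_bigtheta[OF assms, of "min (l - 1) (poset_width P - 1)"]) auto
qed

end
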